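(* Let $\mathcal{S}_n$ be the Permutohedron on $n$ letters (the weak Bruhat order on permutations of $n$ elements). If $\alpha$ is an atomic cover of $\mathcal{S}_n$, then $\mathrm{Cov}(\mathcal{S}_n,\alpha)$ is isomorphic (as a poset) to $\mathcal{S}_{n-1}$.
   Context: $\mathcal{S}_n$ is the set of permutations $w=w_1\ldots w_n$ of $\{1,\ldots,n\}$ ordered by the weak Bruhat order: $w\le w'$ iff $D(w)\subseteq D(w')$, where $D(w)$ is the set of pairs $(a,b)$ with $a<b$ and $b$ occurring before $a$ in the word $w_1\ldots w_n$. It is a finite lattice whose covers are $w\prec w\circ\sigma^i$ with $w_i<w_{i+1}$, where $\sigma^i$ is the transposition $(i,i+1)$. For a finite lattice $L$, $\mathrm{Cov}(L)$ is the set of pairs $\gamma=(\gamma_0,\gamma_1)\in L^2$ such that $\gamma_0<\gamma_1$ with no element strictly between, partially ordered by: $\gamma\le\delta$ iff $\gamma_0\le\delta_0$, $\gamma_1\not\le\delta_0$ and $\gamma_1\le\delta_1$. $\mathrm{Cov}(L,\gamma)$ denotes the connected component of $\gamma$ in this poset (with respect to comparability), with the induced order. An atomic cover of $L$ is a cover of the form $(\bot,\alpha_1)$, where $\bot$ is the least element and $\alpha_1$ is an atom of $L$. *)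

theory Defs
  imports "HOL-Algebra.Order" "HOL-Combinatorics.Multiset_Permutations"
begin

text \<open>
  Posets are \<open>gorder\<close> records whose equality \<open>eq\<close> is HOL equality.
\<close>

definition poset_isomorphic ::
    "('a, 'c) gorder_scheme \<Rightarrow> ('b, 'd) gorder_scheme \<Rightarrow> bool" where
  "poset_isomorphic A B \<longleftrightarrow>
     partial_order A \<and> partial_order B \<and>
     (\<exists>f. bij_betw f (carrier A) (carrier B) \<and> order_emb A B f)"

definition Cov :: "('a, 'c) gorder_scheme \<Rightarrow> ('a \<times> 'a) gorder" where
  "Cov L =
     \<lparr> carrier = {(x, y). x \<in> carrier L \<and> y \<in> carrier L \<and> x \<sqsubset>\<^bsub>L\<^esub> y \<and>
                    \<not> (\<exists>z \<in> carrier L. x \<sqsubset>\<^bsub>L\<^esub> z \<and> z \<sqsubset>\<^bsub>L\<^esub> y)},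
       eq = (=),
       le = (\<lambda>\<gamma> \<delta>. fst \<gamma> \<sqsubseteq>\<^bsub>L\<^esub> fst \<delta> \<and> \<not> snd \<gamma> \<sqsubseteq>\<^bsub>L\<^esub> fst \<delta> \<and> snd \<gamma> \<sqsubseteq>\<^bsub>L\<^esub> snd \<delta>) \<rparr>"

text \<open>
  The restriction to the carrier inside \<open>equivclp\<close> matters: a zigzag of comparabilities
  may only pass through elements of the poset.
\<close>

definition component :: "'a gorder \<Rightarrow> 'a \<Rightarrow> 'a gorder" where
  "component P x =
     P\<lparr> carrier := {y \<in> carrier P.
         equivclp (\<lambda>u v. u \<in> carrier P \<and> v \<in> carrier P \<and> u \<sqsubseteq>\<^bsub>P\<^esub> v) x y} \<rparr>"

definition Cov_at :: "('a, 'c) gorder_scheme \<Rightarrow> 'a \<times> 'a \<Rightarrow> ('a \<times> 'a) gorder" where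
  "Cov_at L \<gamma> = component (Cov L) \<gamma>"

definition atomic_cover :: "('a, 'c) gorder_scheme \<Rightarrow> 'a \<times> 'a \<Rightarrow> bool" where
  "atomic_cover L \<gamma> \<longleftrightarrow> \<gamma> \<in> carrier (Cov L) \<and> fst \<gamma> = \<bottom>\<^bsub>L\<^esub>"

text \<open>
  A permutation is the word \<open>w\<^sub>1\<dots>w\<^sub>n\<close> of its values; list positions are 0-based, while the
  letters are \<open>1, \<dots>, n\<close>.
\<close>

definition disagreements :: "nat list \<Rightarrow> (nat \<times> nat) set" where
  "disagreements w =
     {(a, b). a < b \<and> (\<exists>i j. i < j \<and> j < length w \<and> w ! i = b \<and> w ! j = a)}"

definition permutohedron :: "nat \<Rightarrow> nat list gorder" where
  "permutohedron n =
     \<lparr> carrier = permutations_of_set {1..n},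
       eq = (=),
       le = (\<lambda>w w'. disagreements w \<subseteq> disagreements w') \<rparr>"

lemma sorted_wrt_distinct_unique:
  assumes "antisymp R" "sorted_wrt R xs" "sorted_wrt R ys" "distinct xs" "distinct ys"
    and "set xs = set ys"
  shows "xs = ys"
  using assms(2-)
proof (induction xs arbitrary: ys)
  case Nil
  then show ?case by simp
next
  case (Cons x xs)
  then obtain y ys' where ys: "ys = y # ys'" by (cases ys) auto
  have "x = y"
  proof (rule ccontr)
    assume "x \<noteq> y"
    then have "y \<in> set xs" "x \<in> set ys'" using Cons.prems(5) ys by auto
    then have "R x y" "R y x" using Cons.prems(1,2) ys by auto
    then show False using \<open>x \<noteq> y\<close> assms(1) by (auto dest: antisympD)
  qed
  moreover have "set xs = set ys'"
    using Cons.prems(3-5) ys \<open>x = y\<close> by (auto simp: insert_ident)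
  ultimately show ?case using Cons.IH[of ys'] Cons.prems(1-4) ys by simp
qed

lemma disagreements_inj:
  assumes "w \<in> permutations_of_set A" "w' \<in> permutations_of_set A"
    and "disagreements w = disagreements w'"
  shows "w = w'"
proof -
  define R where "R x y \<longleftrightarrow> x < y \<and> (x, y) \<notin> disagreements w \<or> y < x \<and> (y, x) \<in> disagreements w"
    for x y
  have sorted: "sorted_wrt R v"
    if "distinct v" "disagreements v = disagreements w" for v
    unfolding sorted_wrt_iff_nth_less
  proof (intro allI impI)
    fix i j assume ij: "i < j" "j < length v"
    have "v ! i \<noteq> v ! j" using that(1) ij by (simp add: nth_eq_iff_index_eq)
    moreover have "(v ! i, v ! j) \<notin> disagreements v"
    proof
      assume "(v ! i, v ! j) \<in> disagreements v"
      then obtain k l where "k < l" "l < length v" "v ! k = v ! j" "v ! l = v ! i"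
        by (auto simp: disagreements_def)
      then show False using that(1) ij by (simp add: nth_eq_iff_index_eq)
    qed
    moreover have "(v ! j, v ! i) \<in> disagreements v" if "v ! j < v ! i"
      using that ij by (auto simp: disagreements_def)
    ultimately show "R (v ! i) (v ! j)"
      unfolding R_def that(2)[symmetric] by (meson nat_neq_iff)
  qed
  have "antisymp R" by (auto simp: R_def antisymp_on_def)
  moreover have "sorted_wrt R w" "sorted_wrt R w'"
    using assms sorted permutations_of_setD(2) by metis+
  ultimately show ?thesis
    using assms
    by (metis permutations_of_setD sorted_wrt_distinct_unique)
qed

lemma partial_order_permutohedron: "partial_order (permutohedron n)"
  by unfold_locales (auto simp: permutohedron_def intro: disagreements_inj)

lemma bottom_permutohedron: "\<bottom>\<^bsub>permutohedron n\<^esub> = [1..<Suc n]"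
proof -
  interpret partial_order "permutohedron n" by (rule partial_order_permutohedron)
  have "disagreements [1..<Suc n] = {}"
    by (auto simp: disagreements_def nth_append simp del: upt_Suc)
  then have *: "least (permutohedron n) [1..<Suc n] (carrier (permutohedron n))"
    by (auto simp: least_def permutohedron_def permutations_of_set_def simp del: upt_Suc)
  show ?thesis
    unfolding bottom_def
    by (rule some_equality[where P = "\<lambda>x. least _ x _", OF *]) (erule least_unique[OF _ *])
qed

end

theory Submission
  imports Defs
begin

text \<open>
  A cover of the weak order swaps two adjacent letters \<open>x < y\<close>, hence adds exactly one
  disagreement \<open>(x, y)\<close>, which we call its label.  Two covers are comparable only if their labels
  agree, and then they are compared by their lower elements.  An atomic cover has label
  \<open>(k, k + 1)\<close> and lies below all covers with this label; these are obtained from the permutations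
  of \<open>n - 1\<close> letters by doubling the letter \<open>k\<close> into \<open>k, k + 1\<close>.
\<close>

text \<open>The order axioms of \<open>B\<close> are carried along \<open>g\<close>, so
  \<open>A\<close> need not be known to be a poset beforehand. This lets the isomorphism be built
  from permutations to covers; the required map is its inverse.\<close>

lemma poset_isomorphic_if_order_reflecting:
  assumes "partial_order B"
    and eq: "eq A = (=)" "eq B = (=)"
    and bij: "bij_betw g (carrier B) (carrier A)"
    and le: "\<And>x y. x \<in> carrier B \<Longrightarrow> y \<in> carrier B \<Longrightarrow> g x \<sqsubseteq>\<^bsub>A\<^esub> g y \<longleftrightarrow> x \<sqsubseteq>\<^bsub>B\<^esub> y"
  shows "poset_isomorphic A B"
proof -
  interpret B: partial_order B by fact
  have A: "carrier A = g ` carrier B"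
    using bij by (simp add: bij_betw_def)
  interpret A: partial_order A
    by unfold_locales (auto simp: eq A le B.le_refl dest: B.le_antisym intro: B.le_trans)
  have "bij_betw (inv_into (carrier B) g) (carrier A) (carrier B)"
    using bij by (rule bij_betw_inv_into)
  moreover have "order_emb A B (inv_into (carrier B) g)"
    unfolding order_emb_def
  proof (intro conjI ballI)
    fix x y assume "x \<in> carrier A" "y \<in> carrier A"
    then show "inv_into (carrier B) g x \<sqsubseteq>\<^bsub>B\<^esub> inv_into (carrier B) g y \<longleftrightarrow> x \<sqsubseteq>\<^bsub>A\<^esub> y"
      using le[of "inv_into (carrier B) g x" "inv_into (carrier B) g y"]
      by (simp add: A inv_into_into f_inv_into_f)
  qed unfold_locales
  ultimately show ?thesis
    using A.partial_order_axioms B.partial_order_axioms by (auto simp: poset_isomorphic_def)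
qed

section \<open>Disagreements of concatenated and swapped words\<close>

lemma disagreements_Nil [simp]: "disagreements [] = {}"
  by (simp add: disagreements_def)

lemma disagreements_Cons:
  "disagreements (x # w) = {(a, b). a < b \<and> b = x \<and> a \<in> set w} \<union> disagreements w"
proof -
  have "(\<exists>i j. i < j \<and> j < length (x # w) \<and> (x # w) ! i = b \<and> (x # w) ! j = a) \<longleftrightarrow>
      (b = x \<and> a \<in> set w) \<or> (\<exists>i j. i < j \<and> j < length w \<and> w ! i = b \<and> w ! j = a)"
    (is "?L \<longleftrightarrow> ?R") for a b
  proof
    assume ?L
    then obtain i j where ij: "i < j" "j < length (x # w)" "(x # w) ! i = b" "(x # w) ! j = a"
      by blast
    then show ?R
      by (cases i; cases j) auto
  next
    assume ?R
    then show ?L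
    proof
      assume "b = x \<and> a \<in> set w"
      then obtain j where "j < length w" "w ! j = a" "b = x" by (auto simp: in_set_conv_nth)
      then show ?L by (intro exI[of _ 0] exI[of _ "Suc j"]) auto
    next
      assume "\<exists>i j. i < j \<and> j < length w \<and> w ! i = b \<and> w ! j = a"
      then obtain i j where "i < j" "j < length w" "w ! i = b" "w ! j = a" by blast
      then show ?L by (intro exI[of _ "Suc i"] exI[of _ "Suc j"]) auto
    qed
  qed
  then show ?thesis
    by (auto simp: disagreements_def)
qed

lemma disagreements_append:
  "disagreements (u @ v) =
    disagreements u \<union> disagreements v \<union> {(a, b). a < b \<and> b \<in> set u \<and> a \<in> set v}"
  by (induction u) (auto simp: disagreements_Cons)

lemma disagreements_subset: "disagreements w \<subseteq> set w \<times> set w"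
  by (auto simp: disagreements_def)

text \<open>Swapping two adjacent letters changes the relative order of no other pair of
  positions.\<close>

lemma disagreements_swap:
  assumes "x < y"
  shows "disagreements (as @ y # x # bs) = insert (x, y) (disagreements (as @ x # y # bs))"
  using assms by (auto simp: disagreements_append disagreements_Cons)

text \<open>By distinctness \<open>x\<close> and \<open>y\<close> occur nowhere else in the word, so
  no other occurrences can put \<open>y\<close> before \<open>x\<close>.\<close>

lemma ascent_not_disagreement:
  assumes "distinct (as @ x # y # bs)" "x < y"
  shows "(x, y) \<notin> disagreements (as @ x # y # bs)"
  using assms disagreements_subset[of as] disagreements_subset[of bs]
  by (auto simp: disagreements_append disagreements_Cons)

section \<open>Covers of the weak order as swaps of adjacent letters\<close>

lemma not_successively_split:
  "\<not> successively R w \<Longrightarrow> \<exists>as x y bs. w = as @ x # y # bs \<and> \<not> R x y"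
proof (induction w rule: induct_list012)
  case (3 x y zs)
  show ?case
  proof (cases "R x y")
    case True
    with 3 obtain as x' y' bs where "y # zs = as @ x' # y' # bs" "\<not> R x' y'" by auto
    then have "x # y # zs = (x # as) @ x' # y' # bs" by simp
    with \<open>\<not> R x' y'\<close> show ?thesis by blast
  next
    case False
    then show ?thesis by blast
  qed
qed auto

text \<open>If all neighbours in \<open>w\<close> stood in the order they have in \<open>v\<close>,
  transitivity would make \<open>w\<close> sorted by position in \<open>v\<close>, hence equal to
  \<open>v\<close>. So some neighbours \<open>x\<close>, \<open>y\<close> occur in \<open>v\<close>
  the other way round. They form an ascent, since otherwise \<open>(y, x)\<close> would be a
  disagreement of \<open>w\<close> but not of \<open>v\<close>.\<close>

lemma ascent_in_larger_permutation:
  assumes w: "w \<in> permutations_of_set A" and v: "v \<in> permutations_of_set A"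
    and less: "disagreements w \<subset> disagreements v"
  obtains as x y bs where "w = as @ x # y # bs" "x < y" "(x, y) \<in> disagreements v"
proof -
  \<comment> \<open>\<open>p\<close> sends a letter to its position in \<open>v\<close>, so the
    relation \<open>R\<close> below means "stands earlier in \<open>v\<close>".\<close>
  define p where "p = inv_into {..<length v} (nth v)"
  have "inj_on (nth v) {..<length v}"
    using v by (auto simp: inj_on_nth permutations_of_set_def)
  then have p: "p (v ! i) = i" if "i < length v" for i
    using that by (simp add: p_def)
  define R where "R x y \<longleftrightarrow> p x < p y" for x y
  have D: "(a, b) \<in> disagreements v \<longleftrightarrow> a < b \<and> R b a" if "a \<in> set v" "b \<in> set v" for a b
  proof -
    obtain i j where ij: "v ! i = b" "v ! j = a" "i < length v" "j < length v"
      using \<open>a \<in> set v\<close> \<open>b \<in> set v\<close> by (auto simp: in_set_conv_nth)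
    have "(\<exists>i j. i < j \<and> j < length v \<and> v ! i = b \<and> v ! j = a) \<longleftrightarrow> i < j"
    proof
      assume "\<exists>i j. i < j \<and> j < length v \<and> v ! i = b \<and> v ! j = a"
      then obtain i' j' where "i' < j'" "j' < length v" "v ! i' = b" "v ! j' = a" by blast
      then show "i < j" using p[of i] p[of j] p[of i'] p[of j'] ij by simp
    qed (use ij in blast)
    then show ?thesis
      using p[of i] p[of j] ij by (simp add: disagreements_def R_def)
  qed
  have "transp R" "antisymp R"
    by (auto simp: R_def transp_def antisymp_on_def)
  have "sorted_wrt R v"
    by (auto simp: sorted_wrt_iff_nth_less R_def p)
  have "\<not> successively R w"
  proof
    assume "successively R w"
    then have "sorted_wrt R w"
      using \<open>transp R\<close> by (simp add: successively_iff_sorted_wrt_strong transp_def)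
    then have "w = v"
      using sorted_wrt_distinct_unique \<open>antisymp R\<close> \<open>sorted_wrt R v\<close> w v
      by (metis permutations_of_setD)
    then show False using less by simp
  qed
  then obtain as x y bs where split: "w = as @ x # y # bs" and "\<not> R x y"
    using not_successively_split by blast
  have "x \<in> set v" "y \<in> set v" "x \<noteq> y"
    using w v split by (auto simp: permutations_of_set_def)
  then have "R y x"
    using \<open>\<not> R x y\<close> p unfolding R_def in_set_conv_nth by (metis linorder_neqE_nat)
  have "x < y"
  proof (rule ccontr)
    assume "\<not> x < y"
    then have "(y, x) \<in> disagreements w"
      using \<open>x \<noteq> y\<close> by (auto simp: split disagreements_append disagreements_Cons)
    then show False
      using less D \<open>x \<in> set v\<close> \<open>y \<in> set v\<close> \<open>\<not> R x y\<close> by blast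
  qed
  then show thesis
    using that split D \<open>R y x\<close> \<open>x \<in> set v\<close> \<open>y \<in> set v\<close> by blast
qed

text \<open>If \<open>v\<close> covers \<open>w\<close>, swapping an ascent of \<open>w\<close> that
  is inverted in \<open>v\<close> gives a word above \<open>w\<close> and still below
  \<open>v\<close>, which must then be \<open>v\<close>. Conversely, a swap adds a single
  disagreement, which leaves no room for a third disagreement set in between.\<close>

lemma cover_permutohedron_iff:
  "(w, v) \<in> carrier (Cov (permutohedron n)) \<longleftrightarrow>
    w \<in> permutations_of_set {1..n} \<and>
    (\<exists>as x y bs. x < y \<and> w = as @ x # y # bs \<and> v = as @ y # x # bs)"
proof
  assume "(w, v) \<in> carrier (Cov (permutohedron n))"
  then have w: "w \<in> permutations_of_set {1..n}" and v: "v \<in> permutations_of_set {1..n}"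
    and "disagreements w \<subseteq> disagreements v" "w \<noteq> v"
    and cov: "\<And>z. z \<in> permutations_of_set {1..n} \<Longrightarrow> disagreements w \<subseteq> disagreements z \<Longrightarrow>
      disagreements z \<subseteq> disagreements v \<Longrightarrow> w = z \<or> z = v"
    by (auto simp: Cov_def permutohedron_def lless_def)
  then have "disagreements w \<subset> disagreements v"
    using disagreements_inj by blast
  with w v obtain as x y bs
    where split: "w = as @ x # y # bs" and "x < y" "(x, y) \<in> disagreements v"
    by (rule ascent_in_larger_permutation)
  then have "as @ y # x # bs = v"
    using cov[of "as @ y # x # bs"] w \<open>disagreements w \<subseteq> disagreements v\<close>
    by (auto simp: disagreements_swap permutations_of_set_def insert_commute)
  then show "w \<in> permutations_of_set {1..n} \<and>
      (\<exists>as x y bs. x < y \<and> w = as @ x # y # bs \<and> v = as @ y # x # bs)"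
    using w split \<open>x < y\<close> by blast
next
  assume "w \<in> permutations_of_set {1..n} \<and>
      (\<exists>as x y bs. x < y \<and> w = as @ x # y # bs \<and> v = as @ y # x # bs)"
  then obtain as x y bs where w: "w \<in> permutations_of_set {1..n}" and "x < y"
    and split: "w = as @ x # y # bs" "v = as @ y # x # bs"
    by blast
  then have v: "v \<in> permutations_of_set {1..n}"
    by (auto simp: permutations_of_set_def insert_commute)
  have D: "disagreements v = insert (x, y) (disagreements w)"
    using \<open>x < y\<close> by (simp add: split disagreements_swap)
  then have "z = w \<or> z = v"
    if "z \<in> permutations_of_set {1..n}" "disagreements w \<subseteq> disagreements z"
      "disagreements z \<subseteq> disagreements v" for z
  proof -
    have "disagreements z = disagreements w \<or> disagreements z = disagreements v"
      using that(2,3) D by auto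
    then show ?thesis
      using disagreements_inj that(1) w v by metis
  qed
  moreover have "w \<noteq> v"
    using \<open>x < y\<close> by (simp add: split)
  ultimately show "(w, v) \<in> carrier (Cov (permutohedron n))"
    using w v D by (auto simp: Cov_def permutohedron_def lless_def)
qed

section \<open>The order on covers and the component of an atomic cover\<close>

definition label :: "nat list \<times> nat list \<Rightarrow> (nat \<times> nat) set" where
  "label \<gamma> = disagreements (snd \<gamma>) - disagreements (fst \<gamma>)"

lemma label_swap:
  assumes "distinct (as @ x # y # bs)" "x < y"
  shows "label (as @ x # y # bs, as @ y # x # bs) = {(x, y)}"
  using ascent_not_disagreement[OF assms] disagreements_swap[OF assms(2)]
  by (auto simp: label_def)

text \<open>Let the two covers add the disagreements \<open>p\<close> and \<open>q\<close>. The
  conditions on the upper element of \<gamma> say that \<open>p\<close> is missing from the lower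
  element of \<delta> but present in its upper one, which forces \<open>p = q\<close>. Conversely,
  \<open>q\<close> is missing from the lower element of \<delta> by definition.\<close>

lemma le_Cov_permutohedron_iff:
  assumes "\<gamma> \<in> carrier (Cov (permutohedron n))" "\<delta> \<in> carrier (Cov (permutohedron n))"
  shows "\<gamma> \<sqsubseteq>\<^bsub>Cov (permutohedron n)\<^esub> \<delta> \<longleftrightarrow>
    label \<gamma> = label \<delta> \<and> disagreements (fst \<gamma>) \<subseteq> disagreements (fst \<delta>)"
proof -
  have "\<exists>p. p \<notin> disagreements (fst \<gamma>) \<and> disagreements (snd \<gamma>) = insert p (disagreements (fst \<gamma>))"
    if \<gamma>: "\<gamma> \<in> carrier (Cov (permutohedron n))" for \<gamma>
  proof -
    obtain as x y bs where w: "fst \<gamma> \<in> permutations_of_set {1..n}" and "x < y"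
      and split: "fst \<gamma> = as @ x # y # bs" "snd \<gamma> = as @ y # x # bs"
      using \<gamma> cover_permutohedron_iff[of "fst \<gamma>" "snd \<gamma>" n] unfolding prod.collapse by blast
    then have "(x, y) \<notin> disagreements (fst \<gamma>)"
      using ascent_not_disagreement[of as x y bs] by (metis permutations_of_setD(2))
    then show ?thesis
      using disagreements_swap[OF \<open>x < y\<close>] split by metis
  qed
  then obtain p q where
    "p \<notin> disagreements (fst \<gamma>)" "disagreements (snd \<gamma>) = insert p (disagreements (fst \<gamma>))"
    "q \<notin> disagreements (fst \<delta>)" "disagreements (snd \<delta>) = insert q (disagreements (fst \<delta>))"
    using assms by meson
  then show ?thesis
    unfolding Cov_def permutohedron_def label_def by auto
qed

text \<open>The label is constant along any zigzag of comparabilities. Conversely, the lower element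
  of \<alpha> is the identity word, which has no disagreements, so one comparability already links
  \<alpha> to each cover with its label.\<close>

lemma component_atomic_cover:
  assumes "atomic_cover (permutohedron n) \<alpha>"
  shows "carrier (Cov_at (permutohedron n) \<alpha>) =
    {\<gamma> \<in> carrier (Cov (permutohedron n)). label \<gamma> = label \<alpha>}"
proof -
  let ?C = "Cov (permutohedron n)"
  let ?R = "\<lambda>u v. u \<in> carrier ?C \<and> v \<in> carrier ?C \<and> u \<sqsubseteq>\<^bsub>?C\<^esub> v"
  have \<alpha>: "\<alpha> \<in> carrier ?C" and "fst \<alpha> = [1..<Suc n]"
    using assms by (simp_all only: atomic_cover_def bottom_permutohedron)
  then have bot: "disagreements (fst \<alpha>) = {}"
    by (auto simp: disagreements_def nth_append simp del: upt_Suc)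
  have "label \<gamma> = label \<alpha>" if "equivclp ?R \<alpha> \<gamma>" for \<gamma>
    using that
  proof (induction rule: equivclp_induct)
    case (step \<beta> \<gamma>)
    from step.hyps(2) have "label \<beta> = label \<gamma>"
      by (elim disjE conjE) (simp_all only: le_Cov_permutohedron_iff)
    with step.IH show ?case by simp
  qed simp
  moreover have "equivclp ?R \<alpha> \<gamma>" if "\<gamma> \<in> carrier ?C" "label \<gamma> = label \<alpha>" for \<gamma>
    using that \<alpha> bot by (intro r_into_equivclp) (auto simp: le_Cov_permutohedron_iff)
  moreover have "carrier (Cov_at (permutohedron n) \<alpha>) = {\<gamma> \<in> carrier ?C. equivclp ?R \<alpha> \<gamma>}"
    by (simp add: Cov_at_def component_def)
  ultimately show ?thesis
    by blast
qed

section \<open>Merging the letters \<open>k\<close> and \<open>Suc k\<close>, and doubling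
  \<open>k\<close>\<close>

definition collapse :: "nat \<Rightarrow> nat \<Rightarrow> nat" where
  "collapse k a = (if a \<le> k then a else a - 1)"

text \<open>Each letter is replaced by the block of its preimages under \<open>collapse k\<close>,
  in increasing order.\<close>

definition double :: "nat \<Rightarrow> nat list \<Rightarrow> nat list" where
  "double k u = concat (map (\<lambda>a. if a < k then [a] else if a = k then [k, Suc k] else [Suc a]) u)"

lemma double_simps [simp]:
  "double k [] = []"
  "double k (a # u) = (if a < k then [a] else if a = k then [k, Suc k] else [Suc a]) @ double k u"
  "double k (u @ v) = double k u @ double k v"
  by (simp_all add: double_def)

lemma set_double: "set (double k u) = collapse k -` set u"
  by (induction u) (auto simp: collapse_def split: if_splits)

lemma distinct_double: "distinct u \<Longrightarrow> distinct (double k u)"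
  by (induction u) (auto simp: set_double collapse_def split: if_splits)

text \<open>Away from \<open>k\<close> and \<open>Suc k\<close>, every letter is the only preimage
  of its value under \<open>collapse k\<close>. This applies to the parts of a word on either side
  of the neighbours \<open>k\<close>, \<open>Suc k\<close>.\<close>

lemma double_map_collapse:
  assumes "k \<notin> set w" "Suc k \<notin> set w"
  shows "double k (map (collapse k) w) = w"
  using assms by (induction w) (auto simp: collapse_def)

lemma collapse_less_iff: "collapse k a \<noteq> collapse k b \<Longrightarrow> collapse k a < collapse k b \<longleftrightarrow> a < b"
  by (auto simp: collapse_def split: if_splits)

text \<open>The block \<open>k, Suc k\<close> is increasing and contributes no disagreement of its
  own, while letters of different blocks inherit the order of the blocks in
  \<open>u\<close>.\<close>

lemma disagreements_double:
  assumes "distinct u"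
  shows "disagreements (double k u) = {(a, b). (collapse k a, collapse k b) \<in> disagreements u}"
  using assms
proof (induction u)
  case (Cons x u)
  have block: "b \<in> set (if x < k then [x] else if x = k then [k, Suc k] else [Suc x]) \<longleftrightarrow>
      collapse k b = x" for b
    by (auto simp: collapse_def)
  have "disagreements (double k (x # u)) = disagreements (double k u) \<union>
      {(a, b). a < b \<and> collapse k b = x \<and> collapse k a \<in> set u}"
    unfolding double_simps(2) disagreements_append block set_double
    by (auto simp: disagreements_Cons)
  also have "\<dots> = {(a, b). (collapse k a, collapse k b) \<in> disagreements (x # u)}"
  proof -
    \<comment> \<open>Since \<open>x\<close> does not occur in \<open>u\<close>, the letters
      \<open>a\<close> and \<open>b\<close> lie in different blocks, and there
      \<open>collapse k\<close> preserves and reflects the strict order.\<close>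
    have "a < b \<and> collapse k b = x \<and> collapse k a \<in> set u \<longleftrightarrow>
        collapse k a < collapse k b \<and> collapse k b = x \<and> collapse k a \<in> set u" for a b
      using Cons.prems collapse_less_iff[of k a b] by (cases "collapse k a = collapse k b") auto
    then show ?thesis
      using Cons by (auto simp only: disagreements_Cons distinct.simps)
  qed
  finally show ?case .
qed simp

lemma surj_collapse: "\<exists>a. collapse k a = b"
  by (rule exI[of _ "if b \<le> k then b else Suc b"]) (auto simp: collapse_def)

text \<open>Both sets on the left are preimages under \<open>collapse k\<close> applied to pairs; as
  \<open>collapse k\<close> is surjective, taking preimages also reflects inclusion.\<close>

lemma disagreements_double_subset_iff:
  assumes "distinct u" "distinct v"
  shows "disagreements (double k u) \<subseteq> disagreements (double k v) \<longleftrightarrow>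
    disagreements u \<subseteq> disagreements v"
  unfolding disagreements_double[OF assms(1)] disagreements_double[OF assms(2)]
  using surj_collapse[of k] by (auto simp: subset_iff) metis

lemma collapse_vimage_interval:
  assumes "1 \<le> k" "k < n"
  shows "collapse k -` {1..n - 1} = {1..n}"
  using assms by (auto simp: collapse_def split: if_splits)

lemma double_permutation:
  assumes "1 \<le> k" "k < n" "u \<in> permutations_of_set {1..n - 1}"
  shows "double k u \<in> permutations_of_set {1..n}"
  using assms collapse_vimage_interval[OF assms(1,2)] distinct_double
  by (simp add: permutations_of_set_def set_double)

text \<open>Dropping \<open>Suc k\<close> and collapsing the remaining letters yields the smaller
  permutation; doubling its letter \<open>k\<close> restores the dropped one in the right
  place.\<close>

lemma permutation_with_ascent_double:
  assumes k: "1 \<le> k" "k < n" and w: "as @ k # Suc k # bs \<in> permutations_of_set {1..n}"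
  obtains as' bs' where "as' @ k # bs' \<in> permutations_of_set {1..n - 1}"
    "double k as' = as" "double k bs' = bs"
proof
  let ?as = "map (collapse k) as" and ?bs = "map (collapse k) bs"
  have dist: "distinct (as @ k # Suc k # bs)" and set: "set (as @ k # Suc k # bs) = {1..n}"
    using w by (auto simp: permutations_of_set_def)
  show "double k ?as = as" "double k ?bs = bs"
    using dist by (auto intro!: double_map_collapse)
  \<comment> \<open>The only letters that \<open>collapse k\<close> identifies are \<open>k\<close>
    and \<open>Suc k\<close>, and the shortened word lacks \<open>Suc k\<close>.\<close>
  have inj: "inj_on (collapse k) (- {Suc k})"
    by (auto simp: inj_on_def collapse_def split: if_splits)
  have eq: "?as @ k # ?bs = map (collapse k) (as @ k # bs)"
    by (simp add: collapse_def)
  have "distinct (map (collapse k) (as @ k # bs))"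
    using dist by (auto simp only: distinct_map intro!: inj_on_subset[OF inj]) auto
  moreover have "set (map (collapse k) (as @ k # bs)) = collapse k ` {1..n}"
  proof -
    \<comment> \<open>Because of this, leaving out \<open>Suc k\<close> does not shrink the
      image.\<close>
    have "collapse k (Suc k) = collapse k k" by (simp add: collapse_def)
    then show ?thesis unfolding set[symmetric] by (simp add: image_Un)
  qed
  moreover have "collapse k ` {1..n} = {1..n - 1}"
    unfolding collapse_vimage_interval[OF k, symmetric]
    using surj_collapse[of k] by (intro surj_image_vimage_eq) (metis surj_def)
  ultimately show "?as @ k # ?bs \<in> permutations_of_set {1..n - 1}"
    unfolding eq by (simp add: permutations_of_set_def)
qed

section \<open>The isomorphism between the component and the smaller permutohedron\<close>

theorem proposition7p2:
  fixes n :: nat and \<alpha> :: "nat list \<times> nat list"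
  assumes "atomic_cover (permutohedron n) \<alpha>"
  shows "poset_isomorphic (Cov_at (permutohedron n) \<alpha>) (permutohedron (n - 1))"
proof -
  let ?C = "Cov (permutohedron n)" and ?A = "Cov_at (permutohedron n) \<alpha>"
    and ?B = "permutohedron (n - 1)"
  have \<alpha>: "\<alpha> \<in> carrier ?C" and "fst \<alpha> = [1..<Suc n]"
    using assms by (simp_all only: atomic_cover_def bottom_permutohedron)
  then obtain as k l bs where id: "[1..<Suc n] = as @ k # l # bs" and "k < l"
    and split: "\<alpha> = (as @ k # l # bs, as @ l # k # bs)"
    using cover_permutohedron_iff by (metis prod.collapse)
  \<comment> \<open>Reading the identity word at the two swapped positions gives
    \<open>k = length as + 1\<close> and \<open>l = Suc k\<close>; comparing lengths gives
    \<open>k < n\<close>.\<close>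
  have "[1..<Suc n] ! length as = k" "[1..<Suc n] ! Suc (length as) = l"
    "length [1..<Suc n] = length as + length bs + 2"
    unfolding id by (simp_all add: nth_append)
  then have l: "l = Suc k" and k: "1 \<le> k" "k < n"
    by (simp_all del: upt_Suc)
  have "distinct (as @ k # l # bs)"
    unfolding id[symmetric] by (rule distinct_upt)
  then have label: "label \<alpha> = {(k, Suc k)}"
    using \<open>k < l\<close> by (simp only: split label_swap l)
  \<comment> \<open>The component becomes concrete: its members swap the neighbouring letters
    \<open>k\<close> and \<open>Suc k\<close>.\<close>
  have swap_k: "\<gamma> \<in> carrier ?A \<longleftrightarrow> fst \<gamma> \<in> permutations_of_set {1..n} \<and>
      (\<exists>as bs. \<gamma> = (as @ k # Suc k # bs, as @ Suc k # k # bs))" for \<gamma>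
  proof
    assume "\<gamma> \<in> carrier ?A"
    then have \<gamma>: "\<gamma> \<in> carrier ?C" "label \<gamma> = {(k, Suc k)}"
      by (simp_all add: component_atomic_cover[OF assms] label)
    then obtain as x y bs where w: "fst \<gamma> \<in> permutations_of_set {1..n}" and "x < y"
      and split: "\<gamma> = (as @ x # y # bs, as @ y # x # bs)"
      using cover_permutohedron_iff by (metis prod.collapse)
    moreover from this have "label \<gamma> = {(x, y)}"
      by (metis fst_conv label_swap permutations_of_setD(2))
    ultimately show "fst \<gamma> \<in> permutations_of_set {1..n} \<and>
        (\<exists>as bs. \<gamma> = (as @ k # Suc k # bs, as @ Suc k # k # bs))"
      using \<gamma>(2) by auto
  next
    assume "fst \<gamma> \<in> permutations_of_set {1..n} \<and>
        (\<exists>as bs. \<gamma> = (as @ k # Suc k # bs, as @ Suc k # k # bs))"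
    then obtain as bs where w: "as @ k # Suc k # bs \<in> permutations_of_set {1..n}"
      and split: "\<gamma> = (as @ k # Suc k # bs, as @ Suc k # k # bs)"
      by auto
    then have "label \<gamma> = label \<alpha>"
      unfolding label split by (intro label_swap) (blast dest: permutations_of_setD(2), simp)
    moreover have "\<gamma> \<in> carrier ?C"
      unfolding split cover_permutohedron_iff using w by blast
    ultimately show "\<gamma> \<in> carrier ?A"
      by (simp add: component_atomic_cover[OF assms])
  qed
  \<comment> \<open>As \<open>k\<close> occurs only once, the lower element determines where the
    swap takes place and hence the upper element. So lower elements may stand for covers.\<close>
  have inj: "inj_on fst (carrier ?A)"
  proof (rule inj_onI)
    fix \<gamma> \<delta> assume \<gamma>\<delta>: "\<gamma> \<in> carrier ?A" "\<delta> \<in> carrier ?A" "fst \<gamma> = fst \<delta>"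
    then obtain as bs as' bs'
      where w: "as @ k # Suc k # bs \<in> permutations_of_set {1..n}"
        "as @ k # Suc k # bs = as' @ k # Suc k # bs'"
        and split: "\<gamma> = (as @ k # Suc k # bs, as @ Suc k # k # bs)"
        "\<delta> = (as' @ k # Suc k # bs', as' @ Suc k # k # bs')"
      unfolding swap_k by (metis fst_conv)
    then have "distinct (as @ k # Suc k # bs)"
      by (metis permutations_of_setD(2))
    then have "k \<notin> set as" "k \<notin> set (Suc k # bs)" by auto
    then have "as = as' \<and> Suc k # bs = Suc k # bs'"
      using w(2) append_Cons_eq_iff by metis
    then show "\<gamma> = \<delta>"
      by (simp add: split)
  qed
  have image: "double k ` carrier ?B = fst ` carrier ?A"
  proof (intro equalityI subsetI)
    fix w assume "w \<in> double k ` carrier ?B"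
    then obtain u where u: "u \<in> permutations_of_set {1..n - 1}" and w: "w = double k u"
      by (auto simp: permutohedron_def)
    \<comment> \<open>From \<open>k < n\<close> the letter \<open>k\<close> is among those of
      \<open>u\<close>, and doubling it creates the required ascent.\<close>
    then have "k \<in> set u" using k by (auto simp: permutations_of_set_def)
    then obtain as bs where "u = as @ k # bs" by (meson split_list)
    then have "w = double k as @ k # Suc k # double k bs" by (simp add: w)
    then show "w \<in> fst ` carrier ?A"
      using double_permutation[OF k u] w
      by (intro image_eqI[where x = "(w, double k as @ Suc k # k # double k bs)"])
        (auto simp: swap_k)
  next
    fix w assume "w \<in> fst ` carrier ?A"
    then obtain as bs where w: "w = as @ k # Suc k # bs" "w \<in> permutations_of_set {1..n}"
      by (auto simp: swap_k)
    then obtain as' bs' where "as' @ k # bs' \<in> permutations_of_set {1..n - 1}"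
      "double k as' = as" "double k bs' = bs"
      using permutation_with_ascent_double[OF k] by metis
    then show "w \<in> double k ` carrier ?B"
      by (intro image_eqI[where x = "as' @ k # bs'"]) (auto simp: w permutohedron_def)
  qed
  have subset: "disagreements (double k u) \<subseteq> disagreements (double k v) \<longleftrightarrow> u \<sqsubseteq>\<^bsub>?B\<^esub> v"
    if "u \<in> carrier ?B" "v \<in> carrier ?B" for u v
    using that by (simp add: permutohedron_def disagreements_double_subset_iff permutations_of_setD(2))
  interpret B: partial_order ?B
    by (rule partial_order_permutohedron)
  \<comment> \<open>Injectivity comes from order reflection: equal images make \<open>u\<close> and
    \<open>v\<close> lie below each other.\<close>
  have "inj_on (double k) (carrier ?B)"
    using subset by (metis B.le_antisym B.eq_is_equal inj_onI order_refl)
  then have "bij_betw (double k) (carrier ?B) (fst ` carrier ?A)"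
    using image by (simp add: bij_betw_def)
  \<comment> \<open>\<open>h\<close> recovers a cover of the component from its lower
    element.\<close>
  moreover define h where "h = inv_into (carrier ?A) fst"
  then have "bij_betw h (fst ` carrier ?A) (carrier ?A)"
    using inj by (simp add: bij_betw_inv_into inj_on_imp_bij_betw)
  ultimately have bij: "bij_betw (h \<circ> double k) (carrier ?B) (carrier ?A)"
    by (rule bij_betw_trans)
  have le: "(h \<circ> double k) u \<sqsubseteq>\<^bsub>?A\<^esub> (h \<circ> double k) v \<longleftrightarrow> u \<sqsubseteq>\<^bsub>?B\<^esub> v"
    if "u \<in> carrier ?B" "v \<in> carrier ?B" for u v
  proof -
    have "(h \<circ> double k) u \<in> carrier ?A" "(h \<circ> double k) v \<in> carrier ?A"
      using bij that by (auto dest: bij_betwE)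
    moreover have "fst ((h \<circ> double k) u) = double k u" "fst ((h \<circ> double k) v) = double k v"
      using that image by (auto simp: h_def intro!: f_inv_into_f)
    \<comment> \<open>Restriction to the component changes only the carrier. All labels agree there,
      so the order reduces to inclusion of the disagreements of the lower elements.\<close>
    moreover have "le ?A = le ?C"
      by (simp add: Cov_at_def component_def)
    ultimately show ?thesis
      using subset[OF that] by (simp add: component_atomic_cover[OF assms] le_Cov_permutohedron_iff)
  qed
  show ?thesis
    by (rule poset_isomorphic_if_order_reflecting[OF partial_order_permutohedron _ _ bij le])
      (simp_all add: Cov_at_def component_def Cov_def permutohedron_def)
qed

end
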